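(* Let $A$ be a Sidon set in an abelian group and let $X$ be any discrete random variable with finite entropy taking values in $A$. Then $\mathbf{s}\{X\}\ge \mathbf{H}\{X\}-1$ (and hence $\mathbf{A}\{X\}\le 2\mathbf{H}\{X\}+1$).
   Context: A subset $A$ of an abelian group is a Sidon set if for all $a,b,a',b'\in A$, $a+b=a'+b'$ implies $\{a,b\}=\{a',b'\}$. $\mathbf{H}$ denotes Shannon entropy in base 2: $\mathbf{H}\{Z\}=\sum_z \mathbf{P}\{Z=z\}\log_2(1/\mathbf{P}\{Z=z\})$. For a discrete random variable $X$ in an abelian group, with $X'$ an independent copy of $X$, the entropic doubling constant is $\mathbf{s}\{X\}=\mathbf{H}\{X+X'\}-\mathbf{H}\{X\}$, and $\mathbf{A}\{X\}=4\mathbf{H}\{X\}-\mathbf{H}\{X+X'\}=3\mathbf{H}\{X\}-\mathbf{s}\{X\}$ is the entropic additive energy of $X$. *)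

theory Defs
  imports "HOL-Probability.Probability"
begin

definition sidon :: "'a::ab_group_add set \<Rightarrow> bool" where
  "sidon A \<longleftrightarrow>
     (\<forall>a\<in>A. \<forall>b\<in>A. \<forall>a'\<in>A. \<forall>b'\<in>A. a + b = a' + b' \<longrightarrow> {a, b} = {a', b'})"

definition discrete_rv :: "'w measure \<Rightarrow> ('w \<Rightarrow> 'a) \<Rightarrow> bool" where
  "discrete_rv M X \<longleftrightarrow> X \<in> M \<rightarrow>\<^sub>M count_space UNIV \<and> countable (X ` space M)"

(* log 2 (1 / 0) = 0, so values of probability 0 contribute nothing.  Since infsum is 0 for a
   divergent family, shannon_entropy is only meaningful under finite_shannon_entropy. *)

definition entropy_term :: "'w measure \<Rightarrow> ('w \<Rightarrow> 'a) \<Rightarrow> 'a \<Rightarrow> real" where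
  "entropy_term M Z z = \<P>(w in M. Z w = z) * log 2 (1 / \<P>(w in M. Z w = z))"

definition finite_shannon_entropy :: "'w measure \<Rightarrow> ('w \<Rightarrow> 'a) \<Rightarrow> bool" where
  "finite_shannon_entropy M Z \<longleftrightarrow> entropy_term M Z summable_on UNIV"

definition shannon_entropy :: "'w measure \<Rightarrow> ('w \<Rightarrow> 'a) \<Rightarrow> real" where
  "shannon_entropy M Z = (\<Sum>\<^sub>\<infinity>z. entropy_term M Z z)"

(* The entropy of X + X', where the independent copy X' of X is realised on the product space:
   the two coordinates of M \<Otimes>\<^sub>M M carry X and X'.  Lemma entropy_sum_copy_eq below shows that an
   independent copy of X living on M itself, if there is one, gives the same value.  The entropy of
   X + X' is at most twice that of X, hence finite whenever the entropy of X is. *)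

definition entropy_sum_copy :: "'w measure \<Rightarrow> ('w \<Rightarrow> 'a::ab_group_add) \<Rightarrow> real" where
  "entropy_sum_copy M X = shannon_entropy (M \<Otimes>\<^sub>M M) (\<lambda>(w, w'). X w + X w')"

definition entropic_doubling :: "'w measure \<Rightarrow> ('w \<Rightarrow> 'a::ab_group_add) \<Rightarrow> real" where
  "entropic_doubling M X = entropy_sum_copy M X - shannon_entropy M X"

definition entropic_energy :: "'w measure \<Rightarrow> ('w \<Rightarrow> 'a::ab_group_add) \<Rightarrow> real" where
  "entropic_energy M X = 4 * shannon_entropy M X - entropy_sum_copy M X"

lemma entropic_energy_eq:
  "entropic_energy M X = 3 * shannon_entropy M X - entropic_doubling M X"
  by (simp add: entropic_energy_def entropic_doubling_def)

lemma emeasure_sum_eq: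
  fixes Y Y' :: "'w \<Rightarrow> 'a::ab_group_add"
  assumes Y: "Y \<in> N \<rightarrow>\<^sub>M count_space UNIV" and Y': "Y' \<in> N \<rightarrow>\<^sub>M count_space UNIV"
    and C: "countable C" "Y ` space N \<subseteq> C"
  shows "emeasure N {w \<in> space N. Y w + Y' w = z} =
    (\<integral>\<^sup>+x. emeasure N {w \<in> space N. Y w = x \<and> Y' w = z - x} \<partial>count_space C)"
proof -
  note [measurable] = Y Y'
  let ?D = "\<lambda>x. {w \<in> space N. Y w = x \<and> Y' w = z - x}"
  have "{w \<in> space N. Y w + Y' w = z} = (\<Union>x\<in>C. ?D x)"
    using C(2) by (auto simp: algebra_simps)
  moreover have "?D x \<in> sets N" for x
    by measurable
  then have "emeasure N (\<Union>x\<in>C. ?D x) = (\<integral>\<^sup>+x. emeasure N (?D x) \<partial>count_space C)"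
    using C(1) by (intro emeasure_UN_countable) (auto simp: disjoint_family_on_def)
  ultimately show ?thesis
    by simp
qed

lemma entropy_sum_copy_eq:
  fixes X X' :: "'w \<Rightarrow> 'a::ab_group_add"
  assumes "prob_space M" and X: "discrete_rv M X"
    and ind: "prob_space.indep_var M (count_space UNIV) X (count_space UNIV) X'"
    and law: "distr M (count_space UNIV) X' = distr M (count_space UNIV) X"
  shows "entropy_sum_copy M X = shannon_entropy M (\<lambda>w. X w + X' w)"
proof -
  interpret prob_space M by fact
  have Xm [measurable]: "X \<in> M \<rightarrow>\<^sub>M count_space UNIV" and C: "countable (X ` space M)"
    using X by (auto simp: discrete_rv_def)
  have X'm [measurable]: "X' \<in> M \<rightarrow>\<^sub>M count_space UNIV"
    using ind by (rule indep_var_rv2)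
  have law': "emeasure M {w \<in> space M. X' w = y} = emeasure M {w \<in> space M. X w = y}" for y
    using arg_cong[OF law, of "\<lambda>D. emeasure D {y}"]
    by (simp add: emeasure_distr vimage_def Int_def conj_commute)
  have 1: "emeasure M {w \<in> space M. X w = x \<and> X' w = y} =
    emeasure M {w \<in> space M. X w = x} * emeasure M {w \<in> space M. X w = y}" for x y
  proof -
    have "prob {w \<in> space M. X w = x \<and> X' w = y} =
        prob {w \<in> space M. X w = x} * prob {w \<in> space M. X' w = y}"
      using indep_varD[OF ind, of "{x}" "{y}"] by (simp add: vimage_def Int_def conj_ac)
    then show ?thesis
      by (subst law'[symmetric]) (simp add: emeasure_eq_measure ennreal_mult)
  qed
  have 2: "emeasure (M \<Otimes>\<^sub>M M) {w \<in> space (M \<Otimes>\<^sub>M M). X (fst w) = x \<and> X (snd w) = y} =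
    emeasure M {w \<in> space M. X w = x} * emeasure M {w \<in> space M. X w = y}" for x y
  proof -
    have "{w \<in> space (M \<Otimes>\<^sub>M M). X (fst w) = x \<and> X (snd w) = y} =
        {w \<in> space M. X w = x} \<times> {w \<in> space M. X w = y}"
      by (auto simp: space_pair_measure)
    then show ?thesis
      by (simp add: emeasure_pair_measure_Times)
  qed
  have "emeasure (M \<Otimes>\<^sub>M M) {w \<in> space (M \<Otimes>\<^sub>M M). X (fst w) + X (snd w) = z} =
      emeasure M {w \<in> space M. X w + X' w = z}" for z
  proof -
    have "(\<lambda>w. X (fst w)) ` space (M \<Otimes>\<^sub>M M) \<subseteq> X ` space M"
      by (auto simp: space_pair_measure)
    then show ?thesis
      by (simp add: emeasure_sum_eq[OF _ _ C] 1 2)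
  qed
  then have "entropy_term (M \<Otimes>\<^sub>M M) (\<lambda>(w, w'). X w + X w') =
      entropy_term M (\<lambda>w. X w + X' w)"
    by (intro ext) (simp add: entropy_term_def measure_def case_prod_unfold)
  then show ?thesis
    by (simp add: entropy_sum_copy_def shannon_entropy_def)
qed

end

theory Submission
  imports Defs
begin

text \<open>
  In a Sidon set a sum determines the unordered pair of its summands, so \<open>X + X'\<close> forgets about
  \<open>(X, X')\<close> at most the order of the two coordinates. That is at most one bit, while
  \<open>(X, X')\<close> has entropy \<open>2 H(X)\<close> by independence. Hence \<open>H(X + X') \<ge> 2 H(X) - 1\<close>, and both
  claims are rearrangements of this inequality.

  The one-bit loss is made precise without conditional entropy. Let \<open>p\<close> be the law of \<open>X\<close> and \<open>q\<close>
  that of \<open>X + X'\<close>. When the atom \<open>(a, b)\<close> has positive mass, the only other such atom that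
  can have the same sum is \<open>(b, a)\<close>, which has the same mass, so that \<open>q (a + b) \<le> 2 p a p b\<close>
  (\<open>sidon_convolution_le\<close>). Thus the surprisal of the sum is at least that of the pair minus one,
  and averaging gives the bound (\<open>entropy_pushforward_ge\<close>). The opposite estimate
  \<open>p a p b \<le> q (a + b)\<close> dominates the entropy series of \<open>X + X'\<close> by that of the pair. This
  convergence has to be established together with the lower bound, since a divergent series would
  be assigned the sum zero.
\<close>

section \<open>Entropy of discrete distributions\<close>

definition surprisal_weight :: "real \<Rightarrow> real" where
  "surprisal_weight t = t * log 2 (1 / t)"

lemma surprisal_weight_nonneg: "0 \<le> t \<Longrightarrow> t \<le> 1 \<Longrightarrow> 0 \<le> surprisal_weight t"
  by (cases "t = 0") (auto simp: surprisal_weight_def intro!: mult_nonneg_nonneg)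

text \<open>
  For positive weights this is the additivity of surprisal under independence; a weight zero on
  either side makes every term vanish.
\<close>

lemma surprisal_weight_mult:
  assumes "0 \<le> s" "0 \<le> t"
  shows "surprisal_weight (s * t) = s * surprisal_weight t + surprisal_weight s * t"
proof (cases "s = 0 \<or> t = 0")
  case False
  then have "log 2 (1 / (s * t)) = log 2 (1 / s) + log 2 (1 / t)"
    using assms log_mult[of "1 / s" "1 / t" 2] by (simp add: log_divide log_mult)
  then show ?thesis
    by (simp add: surprisal_weight_def algebra_simps)
qed (auto simp: surprisal_weight_def)

lemma entropy_term_eq: "entropy_term M Z z = surprisal_weight (\<P>(w in M. Z w = z))"
  by (simp add: entropy_term_def surprisal_weight_def)

lemma has_sum_product_nonneg:
  fixes p q :: "'b \<Rightarrow> real"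
  assumes p: "\<And>x. 0 \<le> p x" "(p has_sum S) UNIV" and q: "\<And>x. 0 \<le> q x" "(q has_sum T) UNIV"
  shows "((\<lambda>(x, y). p x * q y) has_sum S * T) UNIV"
proof -
  have inner: "((\<lambda>y. (\<lambda>(x, y). p x * q y) (x, y)) has_sum p x * T) UNIV" for x
    using has_sum_cmult_right[OF q(2), of "p x"] by simp
  have outer: "((\<lambda>x. p x * T) has_sum S * T) UNIV"
    by (rule has_sum_cmult_left[OF p(2)])
  have "(\<lambda>(x, y). p x * q y) summable_on UNIV \<times> UNIV"
    using inner has_sum_imp_summable[OF outer] p(1) q(1)
    by (intro summable_on_SigmaI[where g = "\<lambda>x. p x * T"]) auto
  with inner outer have "((\<lambda>(x, y). p x * q y) has_sum S * T) (UNIV \<times> UNIV)"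
    by (intro has_sum_SigmaI[where g = "\<lambda>x. p x * T"]) auto
  then show ?thesis
    by simp
qed

text \<open>
  The entropy of two independent copies: the surprisal of a pair splits into the surprisals of its
  coordinates, and the other coordinate sums out to one in each of the two resulting series.
\<close>

lemma has_sum_entropy_product:
  fixes p :: "'b \<Rightarrow> real"
  assumes p: "\<And>x. 0 \<le> p x" "\<And>x. p x \<le> 1" "(p has_sum 1) UNIV"
    and H: "((\<lambda>x. surprisal_weight (p x)) has_sum H) UNIV"
  shows "((\<lambda>(x, y). surprisal_weight (p x * p y)) has_sum 2 * H) UNIV"
proof -
  have \<eta>: "0 \<le> surprisal_weight (p x)" for x
    by (intro surprisal_weight_nonneg p)
  have "((\<lambda>z. (case z of (x, y) \<Rightarrow> p x * surprisal_weight (p y)) +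
      (case z of (x, y) \<Rightarrow> surprisal_weight (p x) * p y)) has_sum 1 * H + H * 1) UNIV"
    by (intro has_sum_add has_sum_product_nonneg p H \<eta>)
  moreover have "(case z of (x, y) \<Rightarrow> p x * surprisal_weight (p y)) +
      (case z of (x, y) \<Rightarrow> surprisal_weight (p x) * p y) =
      (case z of (x, y) \<Rightarrow> surprisal_weight (p x * p y))" for z
    using surprisal_weight_mult[OF p(1) p(1)] by (cases z) simp
  ultimately show ?thesis
    by simp
qed

text \<open>
  Applying a map \<open>f\<close> to a variable with law \<open>g\<close> loses at most \<open>log 2 K\<close> bits if no atom of
  positive mass weighs less than a \<open>K\<close>-th part of its fibre: then the surprisal of such an atom
  exceeds that of its image by at most \<open>log 2 K\<close>. The entropy of the image is written as a series over the atoms, grouped by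
  fibres, which makes it comparable term by term with the entropy of \<open>g\<close>. That an atom weighs no
  more than its fibre gives the upper bound from which convergence follows.
\<close>

lemma entropy_pushforward_ge:
  fixes g :: "'b \<Rightarrow> real" and f :: "'b \<Rightarrow> 'c" and q :: "'c \<Rightarrow> real"
  assumes g: "\<And>x. 0 \<le> g x" "(g has_sum 1) UNIV"
    and H: "((\<lambda>x. surprisal_weight (g x)) has_sum H) UNIV"
    and q: "\<And>z. (g has_sum q z) {x. f x = z}"
    and K: "0 < K" "\<And>x. 0 < g x \<Longrightarrow> q (f x) \<le> K * g x"
  shows "\<exists>H'\<ge>H - log 2 K. ((\<lambda>z. surprisal_weight (q z)) has_sum H') UNIV"
proof -
  have q01: "0 \<le> q z" "q z \<le> 1" for z
    using has_sum_nonneg[OF q] has_sum_mono2[OF q g(2)] g(1) by auto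
  have g_le: "g x \<le> q (f x)" for x
    using finite_sum_le_has_sum[OF q, of "{x}"] g(1) by simp
  define G where "G x = surprisal_weight (g x)" for x
  \<comment> \<open>Tagging each atom with its image turns sums over all atoms into sums over a dependent
      product, which can be evaluated fibre by fibre.\<close>
  have fibrewise: "((\<lambda>(z, x). h x) has_sum s) (SIGMA z:UNIV. {x. f x = z}) \<longleftrightarrow>
      (h has_sum s) UNIV" for h :: "'b \<Rightarrow> real" and s
    by (rule has_sum_reindex_bij_witness[where i = "\<lambda>x. (f x, x)" and j = snd]) auto
  define F where "F z = infsum G {x. f x = z}" for z
  have F: "(G has_sum F z) {x. f x = z}" for z
    unfolding F_def
    using has_sum_imp_summable[OF H] unfolding G_def
    by (intro has_sum_infsum) (rule summable_on_subset_banach, auto)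
  have sum_F: "(F has_sum H) UNIV"
    using fibrewise[of G H] H F unfolding G_def[symmetric]
    by (intro has_sum_SigmaD[where f = "\<lambda>(z, x). G x" and B = "\<lambda>z. {x. f x = z}"]) auto
  have sum_q: "(q has_sum 1) UNIV"
    using fibrewise[of g 1] g q
    by (intro has_sum_SigmaD[where f = "\<lambda>(z, x). g x" and B = "\<lambda>z. {x. f x = z}"]) auto
  have \<eta>q: "((\<lambda>x. g x * log 2 (1 / q z)) has_sum surprisal_weight (q z)) {x. f x = z}" for z
    unfolding surprisal_weight_def by (rule has_sum_cmult_left[OF q])
  have upper: "surprisal_weight (q z) \<le> F z" for z
  proof (rule has_sum_mono[OF \<eta>q F])
    fix x assume "x \<in> {x. f x = z}"
    then have "0 < g x \<Longrightarrow> log 2 (1 / q z) \<le> log 2 (1 / g x)"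
      using g_le[of x] by (simp add: log_divide)
    then show "g x * log 2 (1 / q z) \<le> G x"
      using g(1)[of x] by (cases "g x = 0") (auto simp: G_def surprisal_weight_def)
  qed
  have lower: "F z + - log 2 K * q z \<le> surprisal_weight (q z)" for z
  proof (rule has_sum_mono)
    show "((\<lambda>x. G x + - log 2 K * g x) has_sum F z + - log 2 K * q z) {x. f x = z}"
      by (intro has_sum_add has_sum_cmult_right F q)
    fix x assume "x \<in> {x. f x = z}"
    then have x: "f x = z" by simp
    have "log 2 (1 / g x) - log 2 K \<le> log 2 (1 / q z)" if "0 < g x"
    proof -
      have "0 < q z"
        using g_le[of x] x that by simp
      have "log 2 (q z) \<le> log 2 (K * g x)"
        using K(2)[OF that] x K(1) that \<open>0 < q z\<close> by simp
      then show ?thesis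
        using that K(1) \<open>0 < q z\<close> by (simp add: log_mult log_divide)
    qed
    then show "G x + - log 2 K * g x \<le> g x * log 2 (1 / q z)"
      using g(1)[of x] mult_left_mono[of "log 2 (1 / g x) - log 2 K" "log 2 (1 / q z)" "g x"]
      by (cases "g x = 0") (auto simp: G_def surprisal_weight_def algebra_simps)
  qed (rule \<eta>q)
  have "(\<lambda>z. surprisal_weight (q z)) summable_on UNIV"
    by (rule summable_on_comparison_test[OF has_sum_imp_summable[OF sum_F]])
       (auto intro: upper surprisal_weight_nonneg q01)
  then obtain H' where H': "((\<lambda>z. surprisal_weight (q z)) has_sum H') UNIV"
    by (auto simp: summable_on_def)
  have "((\<lambda>z. F z + - log 2 K * q z) has_sum H + - log 2 K * 1) UNIV"
    by (intro has_sum_add has_sum_cmult_right sum_F sum_q)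
  from has_sum_mono[OF this H' lower] have "H - log 2 K \<le> H'"
    by simp
  with H' show ?thesis
    by blast
qed

section \<open>Sums in a Sidon set\<close>

text \<open>
  The Sidon property leaves only \<open>a\<close> and \<open>b\<close> as possible first summands of \<open>a + b\<close>, and both
  contribute the product of the two weights. For \<open>a = b\<close> there is a single contribution, and the
  bound is not sharp.
\<close>

lemma sidon_convolution_le:
  fixes p :: "'a::ab_group_add \<Rightarrow> real"
  assumes A: "sidon A" and p: "\<And>x. 0 \<le> p x" "\<And>x. p x \<noteq> 0 \<Longrightarrow> x \<in> A"
    and q: "((\<lambda>x. p x * p (a + b - x)) has_sum q) UNIV"
    and ab: "p a \<noteq> 0" "p b \<noteq> 0"
  shows "q \<le> 2 * (p a * p b)"
proof -
  have "{x, a + b - x} = {a, b}" if "p x * p (a + b - x) \<noteq> 0" for x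
  proof -
    have "x \<in> A" "a + b - x \<in> A" "a \<in> A" "b \<in> A"
      using that ab p(2) by auto
    moreover have "x + (a + b - x) = a + b"
      by simp
    ultimately show ?thesis
      using A unfolding sidon_def by blast
  qed
  then have "p x * p (a + b - x) = 0" if "x \<notin> {a, b}" for x
    using that by blast
  then have "((\<lambda>x. p x * p (a + b - x)) has_sum q) {a, b}"
    using q by (subst has_sum_cong_neutral[where T = UNIV and g = "\<lambda>x. p x * p (a + b - x)"]) auto
  then have "q = (\<Sum>x\<in>{a, b}. p x * p (a + b - x))"
    by (simp add: has_sum_finite_iff)
  also have "\<dots> \<le> 2 * (p a * p b)"
    using p(1) by (cases "a = b") simp_all
  finally show ?thesis .
qed

section \<open>Laws of discrete random variables\<close>

text \<open>
  Countable additivity as an unordered real sum, the form of summation in which the entropy is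
  defined.
\<close>

lemma (in finite_measure) measure_has_sum_UN:
  assumes I: "countable I" and A: "\<And>i. i \<in> I \<Longrightarrow> A i \<in> sets M" "disjoint_family_on A I"
  shows "((\<lambda>i. measure M (A i)) has_sum measure M (\<Union>i\<in>I. A i)) I"
proof -
  have "(\<integral>\<^sup>+i. ennreal (measure M (A i)) \<partial>count_space I) = ennreal (measure M (\<Union>i\<in>I. A i))"
    using emeasure_UN_countable[of I A M] assms by (simp add: emeasure_eq_measure)
  then have bochner: "has_bochner_integral (count_space I) (\<lambda>i. measure M (A i))
      (measure M (\<Union>i\<in>I. A i))"
    by (intro has_bochner_integral_nn_integral) auto
  then have abs: "Infinite_Set_Sum.abs_summable_on (\<lambda>i. measure M (A i)) I"
    unfolding Infinite_Set_Sum.abs_summable_on_def by (rule integrable.intros)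
  have "infsum (\<lambda>i. measure M (A i)) I = measure M (\<Union>i\<in>I. A i)"
    using bochner infsetsum_infsum[OF abs]
    by (simp add: infsetsum_def has_bochner_integral_iff)
  moreover have "(\<lambda>i. measure M (A i)) summable_on I"
    using abs abs_summable_equivalent[of "\<lambda>i. measure M (A i)" I] by simp
  ultimately show ?thesis
    using has_sum_infsum by metis
qed

lemma has_sum_prob_discrete:
  assumes "prob_space M" and X: "discrete_rv M X"
  shows "((\<lambda>x. \<P>(w in M. X w = x)) has_sum 1) UNIV"
proof -
  interpret prob_space M by fact
  have [measurable]: "X \<in> M \<rightarrow>\<^sub>M count_space UNIV" and C: "countable (X ` space M)"
    using X by (auto simp: discrete_rv_def)
  have "((\<lambda>x. \<P>(w in M. X w = x)) has_sum prob (\<Union>x\<in>X ` space M. {w \<in> space M. X w = x}))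
      (X ` space M)"
    by (rule measure_has_sum_UN[OF C]) (auto simp: disjoint_family_on_def)
  also have "(\<Union>x\<in>X ` space M. {w \<in> space M. X w = x}) = space M"
    by auto
  finally have "((\<lambda>x. \<P>(w in M. X w = x)) has_sum 1) (X ` space M)"
    by (simp add: prob_space)
  moreover have "\<P>(w in M. X w = x) = 0" if "x \<notin> X ` space M" for x
  proof -
    have "{w \<in> space M. X w = x} = {}" using that by auto
    then show ?thesis by (metis measure_empty)
  qed
  ultimately show ?thesis
    by (subst has_sum_cong_neutral[where T = "X ` space M"]) auto
qed

text \<open>
  The law of \<open>X + X'\<close> is the convolution of the law of \<open>X\<close> with itself: the event that the sum is
  \<open>z\<close> is partitioned by the value of the first summand into rectangles of the product space.
\<close>

lemma has_sum_prob_sum_copy: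
  fixes X :: "'w \<Rightarrow> 'a::ab_group_add"
  assumes "prob_space M" and X: "discrete_rv M X"
  shows "((\<lambda>x. \<P>(w in M. X w = x) * \<P>(w in M. X w = z - x))
    has_sum \<P>(w in M \<Otimes>\<^sub>M M. (\<lambda>(w, w'). X w + X w') w = z)) UNIV"
proof -
  interpret prob_space M by fact
  interpret P: pair_prob_space M M ..
  have [measurable]: "X \<in> M \<rightarrow>\<^sub>M count_space UNIV" and C: "countable (X ` space M)"
    using X by (auto simp: discrete_rv_def)
  define E where "E x = {w \<in> space M. X w = x} \<times> {w \<in> space M. X w = z - x}" for x
  have E: "E x \<in> sets (M \<Otimes>\<^sub>M M)" for x
    unfolding E_def by measurable
  have prob_E: "P.prob (E x) = \<P>(w in M. X w = x) * \<P>(w in M. X w = z - x)" for x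
    by (simp add: E_def measure_def emeasure_pair_measure_Times enn2real_mult)
  have "((\<lambda>x. P.prob (E x)) has_sum P.prob (\<Union>x\<in>X ` space M. E x)) (X ` space M)"
    by (rule P.measure_has_sum_UN[OF C E]) (auto simp: disjoint_family_on_def E_def)
  also have "(\<Union>x\<in>X ` space M. E x) =
      {w \<in> space (M \<Otimes>\<^sub>M M). (\<lambda>(w, w'). X w + X w') w = z}"
    by (auto simp: E_def space_pair_measure algebra_simps)
  finally have "((\<lambda>x. P.prob (E x)) has_sum
      \<P>(w in M \<Otimes>\<^sub>M M. (\<lambda>(w, w'). X w + X w') w = z)) (X ` space M)" .
  moreover have "P.prob (E x) = 0" if "x \<notin> X ` space M" for x
  proof -
    have "E x = {}" using that by (auto simp: E_def)
    then show ?thesis by simp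
  qed
  ultimately have "((\<lambda>x. P.prob (E x)) has_sum
      \<P>(w in M \<Otimes>\<^sub>M M. (\<lambda>(w, w'). X w + X w') w = z)) UNIV"
    by (subst has_sum_cong_neutral[where T = "X ` space M"]) auto
  then show ?thesis
    by (simp only: prob_E)
qed

section \<open>Entropy of a sum of independent copies in a Sidon set\<close>

text \<open>
  The law of the independent pair is pushed forward along addition, with a loss of
  \<open>log 2 2 = 1\<close> bit by the Sidon property.
\<close>

lemma sidon_entropy_sum_copy_ge:
  fixes X :: "'w \<Rightarrow> 'a::ab_group_add"
  assumes A: "sidon A" and M: "prob_space M" and X: "discrete_rv M X"
    and fin: "finite_shannon_entropy M X" and XA: "\<forall>w\<in>space M. X w \<in> A"
  shows "2 * shannon_entropy M X - 1 \<le> entropy_sum_copy M X"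
proof -
  interpret prob_space M by fact
  define p where "p x = \<P>(w in M. X w = x)" for x
  define q where "q z = \<P>(w in M \<Otimes>\<^sub>M M. (\<lambda>(w, w'). X w + X w') w = z)" for z
  have p: "0 \<le> p x" "p x \<le> 1" for x
    by (auto simp: p_def)
  have sum_p: "(p has_sum 1) UNIV"
    using has_sum_prob_discrete[OF M X] by (simp add: p_def[abs_def])
  have p_A: "x \<in> A" if "p x \<noteq> 0" for x
  proof (rule ccontr)
    assume "x \<notin> A"
    then have "{w \<in> space M. X w = x} = {}" using XA by auto
    with that show False by (metis p_def measure_empty)
  qed
  have q: "((\<lambda>x. p x * p (z - x)) has_sum q z) UNIV" for z
    using has_sum_prob_sum_copy[OF M X] by (simp add: p_def q_def)
  have H: "((\<lambda>x. surprisal_weight (p x)) has_sum shannon_entropy M X) UNIV"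
    using fin unfolding finite_shannon_entropy_def shannon_entropy_def
    by (simp add: entropy_term_eq[abs_def] p_def)
  have "\<exists>H'\<ge>2 * shannon_entropy M X - log 2 2. ((\<lambda>z. surprisal_weight (q z)) has_sum H') UNIV"
  proof (rule entropy_pushforward_ge[where g = "\<lambda>(x, y). p x * p y" and f = "\<lambda>(x, y). x + y"])
    show "((\<lambda>(x, y). p x * p y) has_sum 1) UNIV"
      using has_sum_product_nonneg[OF p(1) sum_p p(1) sum_p] by simp
    show "((\<lambda>x. surprisal_weight (case x of (x, y) \<Rightarrow> p x * p y)) has_sum
        2 * shannon_entropy M X) UNIV"
      using has_sum_entropy_product[OF p sum_p H] by (simp add: case_prod_unfold)
    show "((\<lambda>(x, y). p x * p y) has_sum q z) {x. (case x of (x, y) \<Rightarrow> x + y) = z}" for z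
      by (rule iffD1[OF has_sum_reindex_bij_witness[where j = "\<lambda>x. (x, z - x)" and i = fst] q]) auto
    show "q (case x of (x, y) \<Rightarrow> x + y) \<le> 2 * (case x of (x, y) \<Rightarrow> p x * p y)"
      if "0 < (case x of (x, y) \<Rightarrow> p x * p y)" for x
    proof (cases x)
      case (Pair a b)
      then show ?thesis
        using sidon_convolution_le[OF A p(1) p_A q[of "a + b"]] that by fastforce
    qed
  qed (use p in auto)
  then obtain H' where "2 * shannon_entropy M X - log 2 2 \<le> H'"
      "((\<lambda>z. surprisal_weight (q z)) has_sum H') UNIV"
    by blast
  moreover from this(2) have "entropy_sum_copy M X = H'"
    unfolding entropy_sum_copy_def shannon_entropy_def
    by (simp add: entropy_term_eq[abs_def] q_def infsumI)
  ultimately show ?thesis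
    by simp
qed

theorem proposition11:
  fixes A :: "'a::ab_group_add set"
    and M :: "'w measure"
    and X :: "'w \<Rightarrow> 'a"
  assumes "sidon A"
    and "prob_space M"
    and "discrete_rv M X"
    and "finite_shannon_entropy M X"
    and "\<forall>w\<in>space M. X w \<in> A"
  shows "entropic_doubling M X \<ge> shannon_entropy M X - 1 \<and>
         entropic_energy M X \<le> 2 * shannon_entropy M X + 1"
  using sidon_entropy_sum_copy_ge[OF assms]
  by (simp add: entropic_doubling_def entropic_energy_def)

end
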